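(* Let $V$ be a simple $\mathfrak{S}$-module. Then the following two conditions are equivalent: (i) $V$ is a locally finite $\mathcal{H}$-module; (ii) $V$ is a quasi-Whittaker module for $\mathfrak{S}$ (that is, a quasi-Whittaker module of type $\phi$ for some Lie algebra homomorphism $\phi:\mathcal{H}\to\mathbb{C}$).
   Context: The Schrödinger algebra $\mathfrak{S}$ is the complex Lie algebra with basis $e,h,f,p,q,z$ and brackets $[h,e]=2e$, $[h,f]=-2f$, $[e,f]=h$, $[h,p]=p$, $[h,q]=-q$, $[p,q]=z$, $[e,q]=p$, $[p,f]=-q$, $[f,q]=0$, $[e,p]=0$, $[z,\mathfrak{S}]=0$. Its Heisenberg subalgebra is $\mathcal{H}=\mathrm{span}_{\mathbb{C}}\{p,q,z\}$. For a Lie algebra homomorphism $\phi:\mathcal{H}\to\mathbb{C}$ (so $\phi(z)=0$) and an $\mathfrak{S}$-module $V$, a nonzero vector $v\in V$ is a quasi-Whittaker vector of type $\phi$ if $xv=\phi(x)v$ for all $x\in\mathcal{H}$. $V$ is a quasi-Whittaker module for $\mathfrak{S}$ of type $\phi$ if it contains a cyclic quasi-Whittaker vector $v$ of type $\phi$, i.e. one with $V=\mathcal{U}(\mathfrak{S})v$. A module over a Lie algebra $L$ is called locally finite if every nonzero element is contained in a finite-dimensional $L$-submodule. *)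

theory Defs
  imports Complex_Main "HOL-Library.Poly_Mapping"
begin

subsection \<open>Complex Lie algebras\<close>

class complex_lie_algebra = ab_group_add +
  fixes lie_scale :: "complex \<Rightarrow> 'a \<Rightarrow> 'a"
    and bracket :: "'a \<Rightarrow> 'a \<Rightarrow> 'a"
  assumes lie_scale_add_right: "lie_scale c (x + y) = lie_scale c x + lie_scale c y"
    and lie_scale_add_left: "lie_scale (c + d) x = lie_scale c x + lie_scale d x"
    and lie_scale_scale: "lie_scale c (lie_scale d x) = lie_scale (c * d) x"
    and lie_scale_one: "lie_scale 1 x = x"
    and bracket_add_left: "bracket (x + y) w = bracket x w + bracket y w"
    and bracket_add_right: "bracket w (x + y) = bracket w x + bracket w y"
    and bracket_scale_left: "bracket (lie_scale c x) y = lie_scale c (bracket x y)"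
    and bracket_scale_right: "bracket x (lie_scale c y) = lie_scale c (bracket x y)"
    and bracket_self: "bracket x x = 0"
    and jacobi: "bracket x (bracket y w) + bracket y (bracket w x) + bracket w (bracket x y) = 0"

lemma vector_space_lie_scale:
  "vector_space (lie_scale :: complex \<Rightarrow> 'l::complex_lie_algebra \<Rightarrow> 'l)"
  by unfold_locales
    (simp_all add: lie_scale_add_right lie_scale_add_left lie_scale_scale lie_scale_one)

definition lie_subalgebra :: "'l::complex_lie_algebra set \<Rightarrow> bool" where
  "lie_subalgebra L \<longleftrightarrow>
     module.subspace lie_scale L \<and> (\<forall>x\<in>L. \<forall>y\<in>L. bracket x y \<in> L)"

text \<open>Homomorphisms from a subalgebra \<open>L\<close> to the Lie algebra of complex numbers, whose bracket
  is the commutator, hence zero. Values outside \<open>L\<close> are irrelevant.\<close>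

definition lie_hom_to_complex :: "'l::complex_lie_algebra set \<Rightarrow> ('l \<Rightarrow> complex) \<Rightarrow> bool" where
  "lie_hom_to_complex L \<phi> \<longleftrightarrow>
     (\<forall>x\<in>L. \<forall>y\<in>L. \<phi> (x + y) = \<phi> x + \<phi> y) \<and>
     (\<forall>c. \<forall>x\<in>L. \<phi> (lie_scale c x) = c * \<phi> x) \<and>
     (\<forall>x\<in>L. \<forall>y\<in>L. \<phi> (bracket x y) = \<phi> x * \<phi> y - \<phi> y * \<phi> x)"

subsection \<open>Universal enveloping algebra\<close>

text \<open>\<open>'a lie_word \<Rightarrow>\<^sub>0 complex\<close> is the monoid algebra of words, i.e. the free unital associative
  complex algebra on the set \<open>'a\<close>. Dividing by \<open>env_relations\<close> first makes the generators depend
  linearly on the elements of the Lie algebra (which gives the tensor algebra) and then imposes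
  the commutator relations.\<close>

datatype 'a lie_word = Word (letters: "'a list")

instantiation lie_word :: (type) monoid_add
begin

definition zero_lie_word :: "'a lie_word" where
  "0 = Word []"

definition plus_lie_word :: "'a lie_word \<Rightarrow> 'a lie_word \<Rightarrow> 'a lie_word" where
  "u + w = Word (letters u @ letters w)"

instance
  by intro_classes (simp_all add: zero_lie_word_def plus_lie_word_def)

end

type_synonym 'a free_algebra = "'a lie_word \<Rightarrow>\<^sub>0 complex"

definition free_const :: "complex \<Rightarrow> 'a free_algebra" where
  "free_const c = Poly_Mapping.single 0 c"

definition free_gen :: "'a \<Rightarrow> 'a free_algebra" where
  "free_gen x = Poly_Mapping.single (Word [x]) 1"

definition env_relations :: "'l::complex_lie_algebra free_algebra set" where
  "env_relations =
     {free_gen (x + y) - (free_gen x + free_gen y) | x y. True} \<union>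
     {free_gen (lie_scale c x) - free_const c * free_gen x | c x. True} \<union>
     {free_gen (bracket x y) - (free_gen x * free_gen y - free_gen y * free_gen x) | x y. True}"

inductive_set env_ideal :: "'l::complex_lie_algebra free_algebra set" where
  env_ideal_zero: "0 \<in> env_ideal"
| env_ideal_add: "a \<in> env_ideal \<Longrightarrow> b \<in> env_ideal \<Longrightarrow> a + b \<in> env_ideal"
| env_ideal_gen: "r \<in> env_relations \<Longrightarrow> a * r * b \<in> env_ideal"

lemma env_ideal_mult_left: "a \<in> env_ideal \<Longrightarrow> c * a \<in> env_ideal"
proof (induction rule: env_ideal.induct)
  case env_ideal_zero
  show ?case by (simp add: env_ideal.env_ideal_zero)
next
  case (env_ideal_add a b)
  then show ?case by (simp add: distrib_left env_ideal.env_ideal_add)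
next
  case (env_ideal_gen r a b)
  then show ?case using env_ideal.env_ideal_gen[of r "c * a" b] by (simp add: mult.assoc)
qed

lemma env_ideal_mult_right: "a \<in> env_ideal \<Longrightarrow> a * c \<in> env_ideal"
proof (induction rule: env_ideal.induct)
  case env_ideal_zero
  show ?case by (simp add: env_ideal.env_ideal_zero)
next
  case (env_ideal_add a b)
  then show ?case by (simp add: distrib_right env_ideal.env_ideal_add)
next
  case (env_ideal_gen r a b)
  then show ?case using env_ideal.env_ideal_gen[of r a "b * c"] by (simp add: mult.assoc)
qed

lemma env_ideal_uminus: "a \<in> env_ideal \<Longrightarrow> - a \<in> env_ideal"
  using env_ideal_mult_left[of a "- 1"] by simp

lemma env_ideal_diff: "a \<in> env_ideal \<Longrightarrow> b \<in> env_ideal \<Longrightarrow> a - b \<in> env_ideal"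
  using env_ideal_add[of a "- b"] env_ideal_uminus[of b] by simp

definition env_eq :: "'l::complex_lie_algebra free_algebra \<Rightarrow> 'l free_algebra \<Rightarrow> bool" where
  "env_eq a b \<longleftrightarrow> a - b \<in> env_ideal"

lemma equivp_env_eq:
  "equivp (env_eq :: 'l::complex_lie_algebra free_algebra \<Rightarrow> 'l free_algebra \<Rightarrow> bool)"
proof (rule equivpI)
  show "reflp (env_eq :: 'l free_algebra \<Rightarrow> _)"
    by (simp add: reflp_def env_eq_def env_ideal_zero)
  show "symp (env_eq :: 'l free_algebra \<Rightarrow> _)"
    unfolding symp_def env_eq_def using env_ideal_uminus by (metis minus_diff_eq)
  show "transp (env_eq :: 'l free_algebra \<Rightarrow> _)"
  proof (rule transpI)
    fix a b c :: "'l free_algebra"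
    assume "env_eq a b" "env_eq b c"
    then have "(a - b) + (b - c) \<in> env_ideal"
      unfolding env_eq_def by (rule env_ideal_add)
    then show "env_eq a c"
      by (simp add: env_eq_def)
  qed
qed

quotient_type (overloaded) 'l enveloping = "'l::complex_lie_algebra free_algebra" / env_eq
  by (rule equivp_env_eq)

instantiation enveloping :: (complex_lie_algebra) "{ring, monoid_mult}"
begin

lift_definition zero_enveloping :: "'a enveloping" is 0 .

lift_definition one_enveloping :: "'a enveloping" is 1 .

lift_definition plus_enveloping :: "'a enveloping \<Rightarrow> 'a enveloping \<Rightarrow> 'a enveloping" is "(+)"
proof -
  fix a b c d :: "'a free_algebra"
  assume "env_eq a b" "env_eq c d"
  then have "(a - b) + (c - d) \<in> env_ideal"
    unfolding env_eq_def by (rule env_ideal_add)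
  then show "env_eq (a + c) (b + d)"
    unfolding env_eq_def by (simp add: algebra_simps)
qed

lift_definition uminus_enveloping :: "'a enveloping \<Rightarrow> 'a enveloping" is uminus
proof -
  fix a b :: "'a free_algebra"
  assume "env_eq a b"
  then have "- (a - b) \<in> env_ideal"
    unfolding env_eq_def by (rule env_ideal_uminus)
  then show "env_eq (- a) (- b)"
    unfolding env_eq_def by simp
qed

lift_definition minus_enveloping :: "'a enveloping \<Rightarrow> 'a enveloping \<Rightarrow> 'a enveloping" is "(-)"
proof -
  fix a b c d :: "'a free_algebra"
  assume "env_eq a b" "env_eq c d"
  then have "(a - b) - (c - d) \<in> env_ideal"
    unfolding env_eq_def by (rule env_ideal_diff)
  then show "env_eq (a - c) (b - d)"
    unfolding env_eq_def by (simp add: algebra_simps)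
qed

lift_definition times_enveloping :: "'a enveloping \<Rightarrow> 'a enveloping \<Rightarrow> 'a enveloping" is "(*)"
proof -
  fix a b c d :: "'a free_algebra"
  assume "env_eq a b" "env_eq c d"
  then have "(a - b) * c + b * (c - d) \<in> env_ideal"
    unfolding env_eq_def
    by (intro env_ideal_add env_ideal_mult_left env_ideal_mult_right)
  then show "env_eq (a * c) (b * d)"
    unfolding env_eq_def by (simp add: algebra_simps)
qed

instance
proof
  fix a b c :: "'a enveloping"
  have refl: "env_eq x x" for x :: "'a free_algebra"
    by (simp add: env_eq_def env_ideal_zero)
  show "a * b * c = a * (b * c)" by transfer (simp add: mult.assoc refl)
  show "a + b + c = a + (b + c)" by transfer (simp add: add.assoc refl)
  show "a + b = b + a" by transfer (simp add: add.commute refl)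
  show "0 + a = a" by transfer (simp add: refl)
  show "- a + a = 0" by transfer (simp add: refl)
  show "a - b = a + - b" by transfer (simp add: refl)
  show "1 * a = a" by transfer (simp add: refl)
  show "a * 1 = a" by transfer (simp add: refl)
  show "(a + b) * c = a * c + b * c" by transfer (simp add: distrib_right refl)
  show "a * (b + c) = a * b + a * c" by transfer (simp add: distrib_left refl)
qed

end

lift_definition env_gen :: "'l::complex_lie_algebra \<Rightarrow> 'l enveloping" is free_gen .

lift_definition env_const :: "complex \<Rightarrow> 'l::complex_lie_algebra enveloping" is free_const .

subsection \<open>Modules\<close>

locale lie_module = vector_space scale
  for scale :: "complex \<Rightarrow> 'v::ab_group_add \<Rightarrow> 'v" +
  fixes act :: "'l::complex_lie_algebra \<Rightarrow> 'v \<Rightarrow> 'v"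
  assumes act_add_left: "act (x + y) v = act x v + act y v"
    and act_scale_left: "act (lie_scale c x) v = scale c (act x v)"
    and act_add_right: "act x (v + w) = act x v + act x w"
    and act_scale_right: "act x (scale c v) = scale c (act x v)"
    and act_bracket: "act (bracket x y) v = act x (act y v) - act y (act x v)"

text \<open>The parameter \<open>L\<close> is a subalgebra, so that \<open>V\<close> can be regarded as an \<open>L\<close>-module by
  restriction.\<close>

definition lie_submodule ::
  "'l set \<Rightarrow> (complex \<Rightarrow> 'v::ab_group_add \<Rightarrow> 'v) \<Rightarrow> ('l \<Rightarrow> 'v \<Rightarrow> 'v) \<Rightarrow> 'v set \<Rightarrow> bool" where
  "lie_submodule L scale act W \<longleftrightarrow>
     module.subspace scale W \<and> (\<forall>x\<in>L. \<forall>w\<in>W. act x w \<in> W)"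

definition simple_lie_module ::
  "(complex \<Rightarrow> 'v::ab_group_add \<Rightarrow> 'v) \<Rightarrow> ('l::complex_lie_algebra \<Rightarrow> 'v \<Rightarrow> 'v) \<Rightarrow> bool" where
  "simple_lie_module scale act \<longleftrightarrow>
     lie_module scale act \<and> (\<exists>v::'v. v \<noteq> 0) \<and>
     (\<forall>W. lie_submodule UNIV scale act W \<longrightarrow> W = {0} \<or> W = UNIV)"

definition finite_dimensional_subspace ::
  "(complex \<Rightarrow> 'v::ab_group_add \<Rightarrow> 'v) \<Rightarrow> 'v set \<Rightarrow> bool" where
  "finite_dimensional_subspace scale W \<longleftrightarrow>
     module.subspace scale W \<and> (\<exists>B. finite B \<and> module.span scale B = W)"

definition locally_finite ::
  "'l set \<Rightarrow> (complex \<Rightarrow> 'v::ab_group_add \<Rightarrow> 'v) \<Rightarrow> ('l \<Rightarrow> 'v \<Rightarrow> 'v) \<Rightarrow> bool" where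
  "locally_finite L scale act \<longleftrightarrow>
     (\<forall>v. v \<noteq> 0 \<longrightarrow>
       (\<exists>W. lie_submodule L scale act W \<and> finite_dimensional_subspace scale W \<and> v \<in> W))"

text \<open>The extension of a Lie algebra action to the free algebra, and the induced action of the
  universal enveloping algebra. The latter is defined through an arbitrary representative; by
  \<open>env_act_abs\<close> the choice is immaterial.\<close>

definition free_act ::
  "(complex \<Rightarrow> 'v::ab_group_add \<Rightarrow> 'v) \<Rightarrow> ('l \<Rightarrow> 'v \<Rightarrow> 'v) \<Rightarrow> 'l free_algebra \<Rightarrow> 'v \<Rightarrow> 'v" where
  "free_act scale act a v =
     (\<Sum>w\<in>Poly_Mapping.keys a. scale (Poly_Mapping.lookup a w) (foldr act (letters w) v))"

definition env_act ::
  "(complex \<Rightarrow> 'v::ab_group_add \<Rightarrow> 'v) \<Rightarrow> ('l::complex_lie_algebra \<Rightarrow> 'v \<Rightarrow> 'v) \<Rightarrow>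
    'l enveloping \<Rightarrow> 'v \<Rightarrow> 'v" where
  "env_act scale act u v = free_act scale act (rep_enveloping u) v"

context lie_module
begin

lemma act_zero_right: "act x 0 = 0"
  using act_scale_right[of x 0 0] by simp

lemma free_act_superset:
  assumes "finite A" "Poly_Mapping.keys a \<subseteq> A"
  shows "free_act scale act a v =
    (\<Sum>w\<in>A. scale (Poly_Mapping.lookup a w) (foldr act (letters w) v))"
  unfolding free_act_def using assms
  by (intro sum.mono_neutral_left) (auto simp: in_keys_iff)

lemma free_act_zero: "free_act scale act 0 v = 0"
  by (simp add: free_act_def)

lemma free_act_add: "free_act scale act (a + b) v = free_act scale act a v + free_act scale act b v"
proof -
  let ?A = "Poly_Mapping.keys a \<union> Poly_Mapping.keys b"
  have "Poly_Mapping.keys (a + b) \<subseteq> ?A" by (rule Poly_Mapping.keys_add)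
  then show ?thesis
    by (simp add: free_act_superset[of ?A] lookup_add scale_left_distrib sum.distrib)
qed

lemma free_act_uminus: "free_act scale act (- a) v = - free_act scale act a v"
  using free_act_add[of a "- a" v] by (simp add: free_act_zero eq_neg_iff_add_eq_0 add.commute)

lemma free_act_diff: "free_act scale act (a - b) v = free_act scale act a v - free_act scale act b v"
  using free_act_add[of a "- b" v] by (simp add: free_act_uminus)

lemma free_act_single:
  "free_act scale act (Poly_Mapping.single w c) v = scale c (foldr act (letters w) v)"
  by (simp add: free_act_def)

lemma free_act_gen: "free_act scale act (free_gen x) v = act x v"
  by (simp add: free_gen_def free_act_single)

lemma free_act_const: "free_act scale act (free_const c) v = scale c v"
  by (simp add: free_const_def free_act_single zero_lie_word_def)

lemma foldr_act_add: "foldr act xs (v + w) = foldr act xs v + foldr act xs w"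
  by (induction xs) (simp_all add: act_add_right)

lemma foldr_act_scale: "foldr act xs (scale c v) = scale c (foldr act xs v)"
  by (induction xs) (simp_all add: act_scale_right)

lemma free_act_add_right: "free_act scale act a (v + w) = free_act scale act a v + free_act scale act a w"
  by (simp add: free_act_def foldr_act_add scale_right_distrib sum.distrib)

lemma free_act_scale_right: "free_act scale act a (scale c v) = scale c (free_act scale act a v)"
  by (simp add: free_act_def foldr_act_scale scale_sum_right mult.commute)

lemma free_act_zero_right: "free_act scale act a 0 = 0"
  using free_act_scale_right[of a 0 0] by simp

lemma free_algebra_induct [case_names single add]:
  fixes a :: "'l free_algebra"
  assumes single: "\<And>w c. P (Poly_Mapping.single w c)"
    and add: "\<And>a b. P a \<Longrightarrow> P b \<Longrightarrow> P (a + b)"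
  shows "P a"
proof -
  have zero: "P 0" using single[of 0 0] by simp
  have eq: "a = (\<Sum>w\<in>Poly_Mapping.keys a. Poly_Mapping.single w (Poly_Mapping.lookup a w))"
    by (intro poly_mapping_eqI)
      (simp add: lookup_sum lookup_single when_def in_keys_iff sum.delta')
  have "P (\<Sum>w\<in>A. Poly_Mapping.single w (Poly_Mapping.lookup a w))" if "finite A" for A
    using that by induction (simp_all add: zero single add)
  then show ?thesis by (subst eq) simp
qed

lemma free_act_mult: "free_act scale act (a * b) v = free_act scale act a (free_act scale act b v)"
proof (induction a rule: free_algebra_induct)
  case (single w c)
  show ?case
  proof (induction b rule: free_algebra_induct)
    case (single w' c')
    show ?case
      by (simp add: mult_single free_act_single plus_lie_word_def foldr_act_scale)
  next
    case (add b b')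
    then show ?case by (simp add: distrib_left free_act_add free_act_add_right)
  qed
next
  case (add a a')
  then show ?case by (simp add: distrib_right free_act_add)
qed

lemma free_act_relation: "r \<in> env_relations \<Longrightarrow> free_act scale act r v = 0"
  by (auto simp: env_relations_def free_act_diff free_act_add free_act_mult free_act_gen
      free_act_const act_add_left act_scale_left act_bracket)

lemma free_act_ideal: "a \<in> env_ideal \<Longrightarrow> free_act scale act a v = 0"
  by (induction rule: env_ideal.induct)
    (simp_all add: free_act_zero free_act_add free_act_mult free_act_relation free_act_zero_right)

lemma env_act_abs: "env_act scale act (abs_enveloping a) v = free_act scale act a v"
proof -
  have "env_eq (rep_enveloping (abs_enveloping a)) a"
    by (rule Quotient3_rep_abs[OF Quotient3_enveloping])
      (simp add: env_eq_def env_ideal_zero)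
  then show ?thesis
    using free_act_ideal[of "rep_enveloping (abs_enveloping a) - a" v]
    by (simp add: env_eq_def env_act_def free_act_diff)
qed

lemma env_act_gen: "env_act scale act (env_gen x) v = act x v"
  by (simp add: env_gen.abs_eq env_act_abs free_act_gen)

lemma env_act_const: "env_act scale act (env_const c) v = scale c v"
  by (simp add: env_const.abs_eq env_act_abs free_act_const)

lemma env_act_one: "env_act scale act 1 v = v"
  using free_act_const[of 1 v] by (simp add: one_enveloping.abs_eq env_act_abs free_const_def)

lemma env_act_add: "env_act scale act (u + u') v = env_act scale act u v + env_act scale act u' v"
proof -
  have "u + u' = abs_enveloping (rep_enveloping u + rep_enveloping u')"
    using Quotient3_abs_rep[OF Quotient3_enveloping] by (metis plus_enveloping.abs_eq)
  then show ?thesis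
    by (simp only: env_act_abs free_act_add) (simp add: env_act_def)
qed

lemma env_act_mult: "env_act scale act (u * u') v = env_act scale act u (env_act scale act u' v)"
proof -
  have "u * u' = abs_enveloping (rep_enveloping u * rep_enveloping u')"
    using Quotient3_abs_rep[OF Quotient3_enveloping] by (metis times_enveloping.abs_eq)
  then show ?thesis
    by (simp only: env_act_abs free_act_mult) (simp add: env_act_def)
qed

end

instance enveloping :: (complex_lie_algebra) ring_1
proof
  interpret triv: lie_module "(*) :: complex \<Rightarrow> complex \<Rightarrow> complex" "\<lambda>(_ :: 'a) _. 0"
    by unfold_locales (simp_all add: algebra_simps)
  show "(0 :: 'a enveloping) \<noteq> 1"
    using triv.env_act_one[of 1] triv.env_act_abs[of 0 1] triv.free_act_zero[of 1]
    by (auto simp: zero_enveloping.abs_eq)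
qed

subsection \<open>The Schroedinger algebra\<close>

text \<open>An element is given by its coordinates in the basis \<open>e, h, f, p, q, z\<close>.\<close>

datatype schroedinger =
  Sch (ce: complex) (ch: complex) (cf: complex) (cp: complex) (cq: complex) (cz: complex)

instantiation schroedinger :: complex_lie_algebra
begin

definition zero_schroedinger :: schroedinger where
  "0 = Sch 0 0 0 0 0 0"

definition plus_schroedinger :: "schroedinger \<Rightarrow> schroedinger \<Rightarrow> schroedinger" where
  "x + y = Sch (ce x + ce y) (ch x + ch y) (cf x + cf y) (cp x + cp y) (cq x + cq y) (cz x + cz y)"

definition uminus_schroedinger :: "schroedinger \<Rightarrow> schroedinger" where
  "- x = Sch (- ce x) (- ch x) (- cf x) (- cp x) (- cq x) (- cz x)"

definition minus_schroedinger :: "schroedinger \<Rightarrow> schroedinger \<Rightarrow> schroedinger" where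
  "x - y = Sch (ce x - ce y) (ch x - ch y) (cf x - cf y) (cp x - cp y) (cq x - cq y) (cz x - cz y)"

definition lie_scale_schroedinger :: "complex \<Rightarrow> schroedinger \<Rightarrow> schroedinger" where
  "lie_scale c x = Sch (c * ce x) (c * ch x) (c * cf x) (c * cp x) (c * cq x) (c * cz x)"

text \<open>The bilinear extension of the bracket relations in \<open>sch_brackets\<close> below.\<close>

definition bracket_schroedinger :: "schroedinger \<Rightarrow> schroedinger \<Rightarrow> schroedinger" where
  "bracket x y = Sch
     (2 * (ch x * ce y - ce x * ch y))
     (ce x * cf y - cf x * ce y)
     (- 2 * (ch x * cf y - cf x * ch y))
     ((ch x * cp y - cp x * ch y) + (ce x * cq y - cq x * ce y))
     (- (ch x * cq y - cq x * ch y) - (cp x * cf y - cf x * cp y))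
     (cp x * cq y - cq x * cp y)"

instance
  by intro_classes
    (simp_all add: zero_schroedinger_def plus_schroedinger_def uminus_schroedinger_def
      minus_schroedinger_def lie_scale_schroedinger_def bracket_schroedinger_def algebra_simps)

end

definition sch_e :: schroedinger where "sch_e = Sch 1 0 0 0 0 0"
definition sch_h :: schroedinger where "sch_h = Sch 0 1 0 0 0 0"
definition sch_f :: schroedinger where "sch_f = Sch 0 0 1 0 0 0"
definition sch_p :: schroedinger where "sch_p = Sch 0 0 0 1 0 0"
definition sch_q :: schroedinger where "sch_q = Sch 0 0 0 0 1 0"
definition sch_z :: schroedinger where "sch_z = Sch 0 0 0 0 0 1"

lemmas sch_basis_defs = sch_e_def sch_h_def sch_f_def sch_p_def sch_q_def sch_z_def

lemma sch_brackets:
  "bracket sch_h sch_e = lie_scale 2 sch_e"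
  "bracket sch_h sch_f = lie_scale (- 2) sch_f"
  "bracket sch_e sch_f = sch_h"
  "bracket sch_h sch_p = sch_p"
  "bracket sch_h sch_q = - sch_q"
  "bracket sch_p sch_q = sch_z"
  "bracket sch_e sch_q = sch_p"
  "bracket sch_p sch_f = - sch_q"
  "bracket sch_f sch_q = 0"
  "bracket sch_e sch_p = 0"
  "bracket sch_z x = 0"
  by (simp_all add: sch_basis_defs bracket_schroedinger_def lie_scale_schroedinger_def
      uminus_schroedinger_def zero_schroedinger_def)

lemma sch_expansion:
  "x = lie_scale (ce x) sch_e + lie_scale (ch x) sch_h + lie_scale (cf x) sch_f
     + lie_scale (cp x) sch_p + lie_scale (cq x) sch_q + lie_scale (cz x) sch_z"
  by (simp add: sch_basis_defs lie_scale_schroedinger_def plus_schroedinger_def)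

definition heisenberg :: "schroedinger set" where
  "heisenberg = module.span lie_scale {sch_p, sch_q, sch_z}"

lemma heisenberg_eq: "heisenberg = {x. ce x = 0 \<and> ch x = 0 \<and> cf x = 0}"
proof -
  interpret V: vector_space "lie_scale :: complex \<Rightarrow> schroedinger \<Rightarrow> schroedinger"
    by (rule vector_space_lie_scale)
  show ?thesis
  proof
    have "V.subspace {x. ce x = 0 \<and> ch x = 0 \<and> cf x = 0}"
      by (simp add: V.subspace_def zero_schroedinger_def plus_schroedinger_def
          lie_scale_schroedinger_def)
    then show "heisenberg \<subseteq> {x. ce x = 0 \<and> ch x = 0 \<and> cf x = 0}"
      unfolding heisenberg_def by (intro V.span_minimal) (auto simp: sch_basis_defs)
  next
    show "{x. ce x = 0 \<and> ch x = 0 \<and> cf x = 0} \<subseteq> heisenberg"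
    proof
      fix x assume "x \<in> {x. ce x = 0 \<and> ch x = 0 \<and> cf x = 0}"
      then have "x = lie_scale (cp x) sch_p + lie_scale (cq x) sch_q + lie_scale (cz x) sch_z"
        by (cases x)
          (simp add: sch_basis_defs lie_scale_schroedinger_def plus_schroedinger_def)
      also have "\<dots> \<in> heisenberg"
        unfolding heisenberg_def by (intro V.span_add V.span_scale V.span_base) auto
      finally show "x \<in> heisenberg" .
    qed
  qed
qed

lemma lie_subalgebra_heisenberg: "lie_subalgebra heisenberg"
proof -
  interpret V: vector_space "lie_scale :: complex \<Rightarrow> schroedinger \<Rightarrow> schroedinger"
    by (rule vector_space_lie_scale)
  have "V.subspace heisenberg" by (simp add: heisenberg_def)
  then show ?thesis
    by (simp add: lie_subalgebra_def) (simp add: heisenberg_eq bracket_schroedinger_def)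
qed

subsection \<open>Quasi-Whittaker modules\<close>

definition quasi_whittaker_vector ::
  "(complex \<Rightarrow> 'v::ab_group_add \<Rightarrow> 'v) \<Rightarrow> (schroedinger \<Rightarrow> 'v \<Rightarrow> 'v) \<Rightarrow>
    (schroedinger \<Rightarrow> complex) \<Rightarrow> 'v \<Rightarrow> bool" where
  "quasi_whittaker_vector scale act \<phi> v \<longleftrightarrow>
     v \<noteq> 0 \<and> (\<forall>x\<in>heisenberg. act x v = scale (\<phi> x) v)"

definition quasi_whittaker_module ::
  "(complex \<Rightarrow> 'v::ab_group_add \<Rightarrow> 'v) \<Rightarrow> (schroedinger \<Rightarrow> 'v \<Rightarrow> 'v) \<Rightarrow>
    (schroedinger \<Rightarrow> complex) \<Rightarrow> bool" where
  "quasi_whittaker_module scale act \<phi> \<longleftrightarrow>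
     (\<exists>v. quasi_whittaker_vector scale act \<phi> v \<and>
          (UNIV :: 'v set) = {env_act scale act u v | u. True})"

end

theory Submission
  imports Defs "HOL-Computational_Algebra.Fundamental_Theorem_Algebra"
begin

text \<open>
  If \<open>V\<close> is locally finite over the Heisenberg algebra \<open>H\<close>, then \<open>V\<close> contains a nonzero
  finite-dimensional \<open>H\<close>-submodule \<open>W\<close>, and it is enough to find a common eigenvector of
  \<open>p, q, z\<close> in \<open>W\<close>, because every nonzero vector of a simple module is cyclic. As \<open>z\<close> is central,
  one may restrict to an eigenspace of \<open>z\<close>, with eigenvalue \<open>c\<close> say. There \<open>p\<close> has an eigenvector \<open>w\<close>,
  and \<open>[p, q] = c\<close> says that \<open>p\<close>, up to its eigenvalue, differentiates: \<open>(p - \<lambda>) P(q) w = c P'(q) w\<close>.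
  If \<open>c\<close> were nonzero, the derivative of any nonzero polynomial \<open>P\<close> with \<open>P(q) w = 0\<close> would again
  be such a polynomial, so that no minimal one could exist. Hence \<open>c = 0\<close>, the operators \<open>p\<close> and
  \<open>q\<close> commute on the eigenspace of \<open>z\<close>, and \<open>q\<close> has an eigenvector inside an eigenspace of \<open>p\<close>
  (lemma \<open>heisenberg_common_eigenvector\<close>). Since \<open>z\<close> kills this vector, its eigenvalues define
  a homomorphism \<open>\<phi>\<close>.

  Conversely, \<open>H\<close> is an ideal of a finite-dimensional Lie algebra. If \<open>W\<close> is a finite-dimensional
  \<open>H\<close>-submodule, then so is the span of \<open>W\<close> and all \<open>y w\<close>, since \<open>x y w = y x w + [x, y] w\<close> and
  \<open>[x, y]\<close> lies in \<open>H\<close> for \<open>x\<close> in \<open>H\<close>. So the vectors that lie in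
  some finite-dimensional \<open>H\<close>-submodule form a submodule over the whole algebra (lemma
  \<open>lie_submodule_locally_finite_vectors\<close>). A quasi-Whittaker vector spans a one-dimensional
  \<open>H\<close>-submodule, so this submodule is nonzero, and by simplicity it is all of \<open>V\<close>.
\<close>

section \<open>Polynomials in a linear operator\<close>

locale linear_operator = vector_space scale
  for scale :: "complex \<Rightarrow> 'v::ab_group_add \<Rightarrow> 'v" +
  fixes T :: "'v \<Rightarrow> 'v"
  assumes op_add: "T (v + w) = T v + T w"
    and op_scale: "T (scale c v) = scale c (T v)"
begin

lemma op_zero: "T 0 = 0"
  using op_scale[of 0 0] by simp

text \<open>The vector \<open>P(T) w\<close>, in Horner form so that it can be handled by induction on \<open>P\<close>.\<close>

definition poly_op :: "complex poly \<Rightarrow> 'v \<Rightarrow> 'v" where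
  "poly_op P w = fold_coeffs (\<lambda>a v. scale a w + T v) P 0"

lemma poly_op_0: "poly_op 0 w = 0"
  by (simp add: poly_op_def)

lemma poly_op_pCons: "poly_op (pCons a P) w = scale a w + T (poly_op P w)"
  by (cases "a = 0 \<and> P = 0") (auto simp: poly_op_def op_zero)

lemma poly_op_add: "poly_op (P + Q) w = poly_op P w + poly_op Q w"
  by (induction P Q rule: poly_induct2)
    (simp_all add: poly_op_0 poly_op_pCons op_add scale_left_distrib algebra_simps)

lemma poly_op_smult: "poly_op (smult c P) w = scale c (poly_op P w)"
  by (induction P) (simp_all add: poly_op_0 poly_op_pCons op_scale scale_right_distrib)

lemma poly_op_diff: "poly_op (P - Q) w = poly_op P w - poly_op Q w"
proof -
  have "poly_op (P + smult (- 1) Q) w = poly_op P w - poly_op Q w"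
    by (simp only: poly_op_add poly_op_smult) simp
  then show ?thesis by simp
qed

lemma poly_op_linear_factor:
  "poly_op ([:- r, 1:] * P) w = T (poly_op P w) - scale r (poly_op P w)"
  by (simp add: poly_op_diff poly_op_smult poly_op_pCons)

lemma poly_op_monom: "poly_op (monom 1 n) w = (T ^^ n) w"
  by (induction n) (simp_all add: monom_Suc monom_0 poly_op_pCons poly_op_0 op_zero)

lemma poly_op_in_subspace:
  assumes "subspace W" "\<And>v. v \<in> W \<Longrightarrow> T v \<in> W" "w \<in> W"
  shows "poly_op P w \<in> W"
  using assms
  by (induction P) (simp_all add: poly_op_0 poly_op_pCons subspace_0 subspace_add subspace_scale)

text \<open>The iterates of \<open>w\<close> cannot all be independent, so one of them, the \<open>n\<close>-th say, depends on
  its predecessors; this relation is a monic polynomial of degree \<open>n\<close>.\<close>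

lemma annihilating_poly_exists:
  assumes W: "\<And>v. v \<in> W \<Longrightarrow> T v \<in> W" "w \<in> W" and B: "finite B" "W \<subseteq> span B"
  obtains P where "P \<noteq> 0" "poly_op P w = 0"
proof -
  define f where "f n = (T ^^ n) w" for n
  have fW: "f n \<in> W" for n
    by (induction n) (simp_all add: f_def W)
  have "\<exists>n. f n \<in> span (f ` {..<n})"
  proof (rule ccontr)
    assume neg: "\<nexists>n. f n \<in> span (f ` {..<n})"
    have "independent (f ` {..<n}) \<and> card (f ` {..<n}) = n" for n
    proof (induction n)
      case 0
      show ?case by (simp add: independent_empty)
    next
      case (Suc n)
      have new: "f n \<notin> span (f ` {..<n})" using neg by simp
      then have "f n \<notin> f ` {..<n}" by (metis span_base)
      moreover have "f ` {..<Suc n} = insert (f n) (f ` {..<n})" by (simp add: lessThan_Suc)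
      ultimately show ?case using Suc new by (simp only: independent_insert) simp
    qed
    moreover have "f ` {..<n} \<subseteq> span B" for n
      using fW B by blast
    ultimately have "n \<le> card B" for n
      using independent_span_bound[OF B(1), of "f ` {..<n}"] by simp
    then show False by (metis Suc_n_not_le_n)
  qed
  then obtain n where n: "f n \<in> span (f ` {..<n})" by blast
  let ?S = "{poly_op P w | P. \<forall>i\<ge>n. coeff P i = 0}"
  have "subspace ?S"
  proof (rule subspaceI)
    show "0 \<in> ?S" using poly_op_0 by force
  next
    fix x y assume "x \<in> ?S" "y \<in> ?S"
    then obtain P Q where "x = poly_op P w" "y = poly_op Q w"
      "\<forall>i\<ge>n. coeff P i = 0" "\<forall>i\<ge>n. coeff Q i = 0" by blast
    then show "x + y \<in> ?S"
      by (auto simp: poly_op_add intro!: exI[of _ "P + Q"])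
  next
    fix c x assume "x \<in> ?S"
    then obtain P where "x = poly_op P w" "\<forall>i\<ge>n. coeff P i = 0" by blast
    then show "scale c x \<in> ?S"
      by (auto simp: poly_op_smult intro!: exI[of _ "smult c P"])
  qed
  moreover have "f ` {..<n} \<subseteq> ?S"
  proof
    fix x assume "x \<in> f ` {..<n}"
    then obtain i where "i < n" "x = poly_op (monom 1 i) w"
      by (auto simp: f_def poly_op_monom)
    then show "x \<in> ?S" by auto
  qed
  ultimately have "f n \<in> ?S" using n span_minimal by blast
  then obtain P where P: "f n = poly_op P w" "coeff P n = 0" by auto
  show thesis
  proof
    show "monom 1 n - P \<noteq> 0"
    proof
      assume "monom 1 n - P = 0"
      then have "coeff (monom 1 n - P) n = 0" by simp
      then show False using P(2) by simp
    qed
    show "poly_op (monom 1 n - P) w = 0"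
      using P(1) by (simp add: poly_op_diff poly_op_monom f_def)
  qed
qed

text \<open>Split off a root of an annihilating polynomial of least degree; the cofactor, which does not
  annihilate \<open>w\<close>, maps \<open>w\<close> to an eigenvector. Finite dimension is expressed by an inclusion in a
  finitely generated span because this form passes to subspaces at once.\<close>

lemma eigenvector_exists:
  assumes W: "subspace W" "\<And>v. v \<in> W \<Longrightarrow> T v \<in> W" and B: "finite B" "W \<subseteq> span B"
    and w: "w \<in> W" "w \<noteq> 0"
  obtains u r where "u \<in> W" "u \<noteq> 0" "T u = scale r u"
proof -
  let ?ann = "\<lambda>P. P \<noteq> 0 \<and> poly_op P w = 0"
  obtain P0 where "?ann P0" using annihilating_poly_exists[OF W(2) w(1) B] by blast
  then obtain P where P: "?ann P" and least: "\<And>Q. ?ann Q \<Longrightarrow> degree P \<le> degree Q"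
    using ex_has_least_nat[of ?ann P0 degree] by blast
  have "degree P \<noteq> 0"
  proof
    assume "degree P = 0"
    then obtain a where "P = [:a:]" by (rule degree_eq_zeroE)
    then show False using P w(2) by (simp add: poly_op_pCons poly_op_0 op_zero)
  qed
  then obtain r where "poly P r = 0"
    using fundamental_theorem_of_algebra[of P] by (auto simp: constant_degree)
  then obtain Q where PQ: "P = [:- r, 1:] * Q" by (auto simp: poly_eq_0_iff_dvd)
  then have "Q \<noteq> 0" using P by auto
  then have "degree Q < degree P" by (simp only: PQ) (subst degree_mult_eq, auto)
  then have "poly_op Q w \<noteq> 0" using least[of Q] \<open>Q \<noteq> 0\<close> by auto
  moreover have "T (poly_op Q w) = scale r (poly_op Q w)"
    using P poly_op_linear_factor[of r Q w] PQ by simp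
  ultimately show thesis using that poly_op_in_subspace[OF W w(1)] by blast
qed

text \<open>The canonical commutation relation \<open>[D, T] = c\<close> has no finite-dimensional representation
  unless \<open>c = 0\<close>: on the vectors \<open>P(T) w\<close>, where \<open>w\<close> is killed by \<open>D\<close>, the operator \<open>D\<close> acts as \<open>c\<close>
  times differentiation of \<open>P\<close>.\<close>

lemma commutation_constant_zero:
  assumes D: "linear_operator scale D"
    and W: "subspace W" "\<And>v. v \<in> W \<Longrightarrow> T v \<in> W" and B: "finite B" "W \<subseteq> span B"
    and comm: "\<And>v. v \<in> W \<Longrightarrow> D (T v) - T (D v) = scale c v"
    and w: "w \<in> W" "w \<noteq> 0" "D w = 0"
  shows "c = 0"
proof (rule ccontr)
  assume "c \<noteq> 0"
  interpret D: linear_operator scale D by (rule D)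
  have deriv: "D (poly_op P w) = scale c (poly_op (pderiv P) w)" for P
  proof (induction P)
    case 0
    show ?case by (simp add: poly_op_0 D.op_zero)
  next
    case (pCons a P)
    have "D (T (poly_op P w)) = T (D (poly_op P w)) + scale c (poly_op P w)"
      using comm[OF poly_op_in_subspace[OF W w(1)]] by (simp add: algebra_simps)
    with pCons.IH show ?case
      by (simp add: poly_op_pCons D.op_add D.op_scale w(3) pderiv_pCons poly_op_add op_scale
          scale_right_distrib add.commute)
  qed
  let ?ann = "\<lambda>P. P \<noteq> 0 \<and> poly_op P w = 0"
  obtain P0 where "?ann P0" using annihilating_poly_exists[OF W(2) w(1) B] by blast
  then obtain P where P: "?ann P" and least: "\<And>Q. ?ann Q \<Longrightarrow> degree P \<le> degree Q"
    using ex_has_least_nat[of ?ann P0 degree] by blast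
  have deg: "degree P \<noteq> 0"
  proof
    assume "degree P = 0"
    then obtain a where "P = [:a:]" by (rule degree_eq_zeroE)
    then show False using P w(2) by (simp add: poly_op_pCons poly_op_0 op_zero)
  qed
  have "poly_op (pderiv P) w = 0"
    using deriv[of P] P \<open>c \<noteq> 0\<close> by (simp add: D.op_zero)
  moreover have "pderiv P \<noteq> 0" using deg by (simp add: pderiv_eq_0_iff)
  ultimately show False using least[of "pderiv P"] deg by (simp add: degree_pderiv)
qed

end

section \<open>Cyclic vectors and locally finite vectors\<close>

context lie_module
begin

lemma linear_operator_act: "linear_operator scale (act x)"
  by unfold_locales (simp_all add: act_add_right act_scale_right)

lemma lie_submodule_cyclic: "lie_submodule UNIV scale act {env_act scale act u v | u. True}"
proof -
  have scale: "\<exists>u'. scale c (env_act scale act u v) = env_act scale act u' v" for c u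
    by (rule exI[of _ "env_const c * u"]) (simp add: env_act_mult env_act_const)
  have "\<exists>u. 0 = env_act scale act u v"
    using scale[of 0 1] by simp
  moreover have "\<exists>u''. env_act scale act u v + env_act scale act u' v = env_act scale act u'' v"
    for u u'
    by (rule exI[of _ "u + u'"]) (simp add: env_act_add)
  moreover have "\<exists>u'. act x (env_act scale act u v) = env_act scale act u' v" for x u
    by (rule exI[of _ "env_gen x * u"]) (simp add: env_act_mult env_act_gen)
  ultimately show ?thesis
    using scale unfolding lie_submodule_def by (auto intro!: subspaceI)
qed

lemma simple_imp_cyclic:
  assumes "simple_lie_module scale act" "v \<noteq> 0"
  shows "(UNIV :: 'v set) = {env_act scale act u v | u. True}"
proof -
  have "v \<in> {env_act scale act u v | u. True}"
    using env_act_one[of v] by (auto intro: exI[of _ 1])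
  then show ?thesis
    using assms lie_submodule_cyclic[of v] unfolding simple_lie_module_def by blast
qed

definition locally_finite_vectors :: "'l set \<Rightarrow> 'v set" where
  "locally_finite_vectors I =
     {v. \<exists>W. lie_submodule I scale act W \<and> finite_dimensional_subspace scale W \<and> v \<in> W}"

lemma locally_finite_vectors_subspace: "subspace (locally_finite_vectors I)"
proof (rule subspaceI)
  have "lie_submodule I scale act {0}"
    by (simp add: lie_submodule_def subspace_single_0 act_zero_right)
  moreover have "finite_dimensional_subspace scale {0}"
    unfolding finite_dimensional_subspace_def
    using span_empty subspace_single_0 by blast
  ultimately show "0 \<in> locally_finite_vectors I"
    unfolding locally_finite_vectors_def by blast
next
  fix v w assume "v \<in> locally_finite_vectors I" "w \<in> locally_finite_vectors I"
  then obtain A B where A: "lie_submodule I scale act (span A)" "finite A" "v \<in> span A"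
    and B: "lie_submodule I scale act (span B)" "finite B" "w \<in> span B"
    unfolding locally_finite_vectors_def finite_dimensional_subspace_def by blast
  have "act x u \<in> span (A \<union> B)" if "x \<in> I" "u \<in> span (A \<union> B)" for x u
    using that A(1) B(1) unfolding span_Un lie_submodule_def
    by (auto simp: act_add_right) blast
  then have "lie_submodule I scale act (span (A \<union> B))"
    by (simp add: lie_submodule_def)
  moreover have "finite_dimensional_subspace scale (span (A \<union> B))"
    unfolding finite_dimensional_subspace_def using A(2) B(2) by (auto intro!: exI[of _ "A \<union> B"])
  moreover have "v + w \<in> span (A \<union> B)"
    using A(3) B(3) unfolding span_Un by blast
  ultimately show "v + w \<in> locally_finite_vectors I"
    unfolding locally_finite_vectors_def by blast
next
  fix c v assume "v \<in> locally_finite_vectors I"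
  then show "scale c v \<in> locally_finite_vectors I"
    unfolding locally_finite_vectors_def lie_submodule_def by (auto intro: subspace_scale)
qed

text \<open>Let \<open>L\<close> be the whole Lie algebra. The subspace \<open>W + L W\<close> is a finite-dimensional \<open>I\<close>-submodule along with \<open>W\<close>: it is spanned by
  the vectors \<open>b\<close> and \<open>g b\<close> for \<open>b\<close> in a finite spanning set of \<open>W\<close> and \<open>g\<close> in a finite spanning
  set of \<open>L\<close>, and \<open>x g b = [x, g] b + g x b\<close> belongs to \<open>W + L W\<close> for \<open>x\<close> in the ideal \<open>I\<close>.\<close>

lemma lie_submodule_locally_finite_vectors:
  assumes G: "finite G" "module.span lie_scale G = (UNIV :: 'l set)"
    and ideal: "\<And>x y. x \<in> I \<Longrightarrow> bracket x y \<in> I"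
  shows "lie_submodule UNIV scale act (locally_finite_vectors I)"
proof -
  interpret L: vector_space "lie_scale :: complex \<Rightarrow> 'l \<Rightarrow> 'l"
    by (rule vector_space_lie_scale)
  have "act y v \<in> locally_finite_vectors I" if v: "v \<in> locally_finite_vectors I" for y v
  proof -
    obtain B where B: "lie_submodule I scale act (span B)" "finite B" "v \<in> span B"
      using v unfolding locally_finite_vectors_def finite_dimensional_subspace_def by blast
    define U where "U = span (B \<union> (\<Union>g\<in>G. act g ` B))"
    have U: "subspace U" by (simp add: U_def)
    have BU: "span B \<subseteq> U" unfolding U_def by (rule span_mono) blast
    have GU: "act g w \<in> U" if "g \<in> G" "w \<in> span B" for g w
    proof -
      have "subspace {w. act g w \<in> U}"
        using U by (intro subspaceI)
          (simp_all add: act_zero_right act_add_right act_scale_right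
            subspace_0 subspace_add subspace_scale)
      moreover have "B \<subseteq> {w. act g w \<in> U}"
        using \<open>g \<in> G\<close> by (auto simp: U_def intro: span_base)
      ultimately show ?thesis using span_minimal that(2) by blast
    qed
    have LU: "act y w \<in> U" if w: "w \<in> span B" for y w
    proof -
      have "act 0 w = 0" using act_add_left[of 0 0 w] by simp
      then have "L.subspace {y. act y w \<in> U}"
        using U by (intro L.subspaceI)
          (simp_all add: act_add_left act_scale_left subspace_0 subspace_add subspace_scale)
      moreover have "G \<subseteq> {y. act y w \<in> U}" using GU w by blast
      ultimately have "L.span G \<subseteq> {y. act y w \<in> U}" by (rule L.span_minimal[rotated])
      then show ?thesis using G(2) by blast
    qed
    have IU: "act x u \<in> U" if x: "x \<in> I" and u: "u \<in> U" for x u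
    proof -
      have stable: "act x' w \<in> span B" if "x' \<in> I" "w \<in> span B" for x' w
        using B(1) that by (simp add: lie_submodule_def)
      have "subspace {w. act x w \<in> U}"
        using U by (intro subspaceI)
          (simp_all add: act_zero_right act_add_right act_scale_right
            subspace_0 subspace_add subspace_scale)
      moreover have "act x b \<in> U" if "b \<in> B" for b
        using stable[OF x span_base[OF that]] BU by blast
      moreover have "act x (act g b) \<in> U" if "g \<in> G" "b \<in> B" for g b
      proof -
        have b: "b \<in> span B" using that(2) by (rule span_base)
        have "act (bracket x g) b \<in> U" using stable[OF ideal[OF x] b] BU by blast
        moreover have "act g (act x b) \<in> U" using GU[OF that(1) stable[OF x b]] .
        moreover have "act x (act g b) = act (bracket x g) b + act g (act x b)"
          by (simp add: act_bracket)
        ultimately show ?thesis using U by (simp add: subspace_add)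
      qed
      ultimately have "span (B \<union> (\<Union>g\<in>G. act g ` B)) \<subseteq> {w. act x w \<in> U}"
        by (intro span_minimal) auto
      then show ?thesis using u unfolding U_def by blast
    qed
    have "lie_submodule I scale act U" using U IU by (simp add: lie_submodule_def)
    moreover have "finite_dimensional_subspace scale U"
      unfolding finite_dimensional_subspace_def using U G(1) B(2)
      by (auto simp: U_def intro!: exI[of _ "B \<union> (\<Union>g\<in>G. act g ` B)"])
    ultimately show ?thesis
      unfolding locally_finite_vectors_def using LU[OF B(3)] by blast
  qed
  then show ?thesis by (simp add: lie_submodule_def locally_finite_vectors_subspace)
qed

end

section \<open>The Heisenberg algebra inside the Schroedinger algebra\<close>

lemma sch_basis_spans:
  "module.span lie_scale {sch_e, sch_h, sch_f, sch_p, sch_q, sch_z} = UNIV"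
proof -
  interpret V: vector_space "lie_scale :: complex \<Rightarrow> schroedinger \<Rightarrow> schroedinger"
    by (rule vector_space_lie_scale)
  have "x \<in> V.span {sch_e, sch_h, sch_f, sch_p, sch_q, sch_z}" for x
    by (subst sch_expansion) (intro V.span_add V.span_scale V.span_base; simp)
  then show ?thesis by blast
qed

lemma heisenberg_ideal: "x \<in> heisenberg \<Longrightarrow> bracket x y \<in> heisenberg"
  by (simp add: heisenberg_eq bracket_schroedinger_def)

lemma heisenberg_basis: "sch_p \<in> heisenberg" "sch_q \<in> heisenberg" "sch_z \<in> heisenberg"
  by (simp_all add: heisenberg_eq sch_basis_defs)

lemma heisenberg_expansion:
  assumes "x \<in> heisenberg"
  shows "x = lie_scale (cp x) sch_p + lie_scale (cq x) sch_q + lie_scale (cz x) sch_z"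
  using assms
  by (cases x) (simp add: heisenberg_eq sch_basis_defs lie_scale_schroedinger_def
      plus_schroedinger_def)

text \<open>Any pair of values on \<open>p\<close> and \<open>q\<close> extends to a homomorphism, because the derived algebra of
  the Heisenberg algebra is spanned by \<open>z\<close>.\<close>

lemma lie_hom_heisenberg: "lie_hom_to_complex heisenberg (\<lambda>x. cp x * a + cq x * b)"
  by (simp add: lie_hom_to_complex_def heisenberg_eq plus_schroedinger_def
      lie_scale_schroedinger_def bracket_schroedinger_def algebra_simps)

context lie_module
begin

text \<open>Successive restriction to eigenspaces of \<open>z\<close>, \<open>p\<close> and \<open>q\<close>. An eigenspace of \<open>p\<close> is stable
  under \<open>q\<close> because \<open>z\<close> acts there by zero, by \<open>commutation_constant_zero\<close>.\<close>

lemma heisenberg_common_eigenvector: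
  fixes P Q Z :: 'l
  assumes PQ: "bracket P Q = Z" and ZP: "bracket Z P = 0" and ZQ: "bracket Z Q = 0"
    and W: "subspace W" "\<And>w. w \<in> W \<Longrightarrow> act P w \<in> W" "\<And>w. w \<in> W \<Longrightarrow> act Q w \<in> W"
      "\<And>w. w \<in> W \<Longrightarrow> act Z w \<in> W"
    and B: "finite B" "W \<subseteq> span B" and w: "w \<in> W" "w \<noteq> 0"
  obtains v a b where "v \<in> W" "v \<noteq> 0" "act P v = scale a v" "act Q v = scale b v" "act Z v = 0"
proof -
  interpret P: linear_operator scale "act P" by (rule linear_operator_act)
  interpret Q: linear_operator scale "act Q" by (rule linear_operator_act)
  interpret Z: linear_operator scale "act Z" by (rule linear_operator_act)
  have act0: "act 0 v = 0" for v using act_add_left[of 0 0 v] by simp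
  have zp: "act Z (act P v) = act P (act Z v)" for v
    using act_bracket[of Z P v] by (simp add: ZP act0)
  have zq: "act Z (act Q v) = act Q (act Z v)" for v
    using act_bracket[of Z Q v] by (simp add: ZQ act0)
  have pq: "act P (act Q v) - act Q (act P v) = act Z v" for v
    using act_bracket[of P Q v] by (simp add: PQ)
  have eigenspace: "subspace {v \<in> S. act x v = scale r v}" if "subspace S" for S x r
    using that by (intro subspaceI)
      (simp_all add: subspace_0 subspace_add subspace_scale act_zero_right act_add_right
        act_scale_right scale_right_distrib mult.commute)
  obtain u c where u: "u \<in> W" "u \<noteq> 0" "act Z u = scale c u"
    using Z.eigenvector_exists[OF W(1,4) B w] by blast
  define W1 where "W1 = {v \<in> W. act Z v = scale c v}"
  have W1: "subspace W1" unfolding W1_def by (rule eigenspace[OF W(1)])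
  have P1: "act P v \<in> W1" if "v \<in> W1" for v
    using that by (simp add: W1_def W(2) zp act_scale_right)
  have Q1: "act Q v \<in> W1" if "v \<in> W1" for v
    using that by (simp add: W1_def W(3) zq act_scale_right)
  have B1: "W1 \<subseteq> span B" using B(2) by (auto simp: W1_def)
  obtain y a where y: "y \<in> W1" "y \<noteq> 0" "act P y = scale a y"
    using P.eigenvector_exists[OF W1 P1 B(1) B1] u by (auto simp: W1_def)
  have "c = 0"
  proof (rule Q.commutation_constant_zero[OF _ W1 Q1 B(1) B1])
    show "linear_operator scale (\<lambda>v. act P v - scale a v)"
      by unfold_locales
        (simp_all add: act_add_right act_scale_right scale_right_distrib
          scale_right_diff_distrib mult.commute)
    show "act P (act Q v) - scale a (act Q v) - act Q (act P v - scale a v) = scale c v"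
      if "v \<in> W1" for v
    proof -
      have "act Q (act P v) = act Q (act P v - scale a v) + scale a (act Q v)"
        by (simp flip: act_add_right act_scale_right)
      then show ?thesis using pq[of v] that by (simp add: W1_def algebra_simps)
    qed
    show "act P y - scale a y = 0" using y(3) by simp
  qed (use y in auto)
  define W2 where "W2 = {v \<in> W1. act P v = scale a v}"
  have W2: "subspace W2" unfolding W2_def by (rule eigenspace[OF W1])
  have Q2: "act Q v \<in> W2" if "v \<in> W2" for v
  proof -
    have "act Z v = 0" using that \<open>c = 0\<close> by (simp add: W2_def W1_def)
    then show ?thesis using that pq[of v] by (simp add: W2_def Q1 act_scale_right)
  qed
  have B2: "W2 \<subseteq> span B" using B1 by (auto simp: W2_def)
  obtain v b where "v \<in> W2" "v \<noteq> 0" "act Q v = scale b v"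
    using Q.eigenvector_exists[OF W2 Q2 B(1) B2, of y] y by (auto simp: W2_def)
  then show thesis using that \<open>c = 0\<close> by (auto simp: W2_def W1_def)
qed

end

theorem theorem2p8:
  fixes scale :: "complex \<Rightarrow> 'v::ab_group_add \<Rightarrow> 'v"
    and act :: "schroedinger \<Rightarrow> 'v \<Rightarrow> 'v"
  assumes "simple_lie_module scale act"
  shows "locally_finite heisenberg scale act \<longleftrightarrow>
    (\<exists>\<phi>. lie_hom_to_complex heisenberg \<phi> \<and> quasi_whittaker_module scale act \<phi>)"
proof -
  interpret lie_module scale act using assms by (simp add: simple_lie_module_def)
  show ?thesis
  proof
    assume lf: "locally_finite heisenberg scale act"
    obtain w :: 'v where w: "w \<noteq> 0" using assms by (auto simp: simple_lie_module_def)
    then obtain W B where W: "lie_submodule heisenberg scale act W" "w \<in> W"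
      and B: "finite B" "span B = W"
      using lf unfolding locally_finite_def finite_dimensional_subspace_def by blast
    have sub: "subspace W" and stable: "\<And>x u. x \<in> heisenberg \<Longrightarrow> u \<in> W \<Longrightarrow> act x u \<in> W"
      using W(1) by (auto simp: lie_submodule_def)
    obtain v a b where v: "v \<noteq> 0" "act sch_p v = scale a v" "act sch_q v = scale b v"
      "act sch_z v = 0"
      by (rule heisenberg_common_eigenvector[OF sch_brackets(6) sch_brackets(11)
            sch_brackets(11) sub stable[OF heisenberg_basis(1)] stable[OF heisenberg_basis(2)]
            stable[OF heisenberg_basis(3)] B(1) equalityD2[OF B(2)] W(2) w])
    let ?\<phi> = "\<lambda>x. cp x * a + cq x * b"
    have "act x v = scale (?\<phi> x) v" if "x \<in> heisenberg" for x
    proof -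
      have "act x v = act (lie_scale (cp x) sch_p + lie_scale (cq x) sch_q
        + lie_scale (cz x) sch_z) v"
        using heisenberg_expansion[OF that] by simp
      then show ?thesis
        by (simp add: act_add_left act_scale_left v scale_left_distrib)
    qed
    then have "quasi_whittaker_vector scale act ?\<phi> v"
      using v(1) by (simp add: quasi_whittaker_vector_def)
    then have "quasi_whittaker_module scale act ?\<phi>"
      using simple_imp_cyclic[OF assms v(1)] unfolding quasi_whittaker_module_def by blast
    then show "\<exists>\<phi>. lie_hom_to_complex heisenberg \<phi> \<and> quasi_whittaker_module scale act \<phi>"
      using lie_hom_heisenberg by blast
  next
    assume "\<exists>\<phi>. lie_hom_to_complex heisenberg \<phi> \<and> quasi_whittaker_module scale act \<phi>"
    then obtain \<phi> v where v: "v \<noteq> 0" "\<And>x. x \<in> heisenberg \<Longrightarrow> act x v = scale (\<phi> x) v"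
      unfolding quasi_whittaker_module_def quasi_whittaker_vector_def by blast
    have "act x u \<in> span {v}" if "x \<in> heisenberg" "u \<in> span {v}" for x u
      using that v(2) unfolding span_singleton
      by (auto simp: act_scale_right)
    then have "lie_submodule heisenberg scale act (span {v})"
      by (simp add: lie_submodule_def)
    moreover have "finite_dimensional_subspace scale (span {v})"
      unfolding finite_dimensional_subspace_def by (auto intro!: exI[of _ "{v}"])
    ultimately have "v \<in> locally_finite_vectors heisenberg"
      unfolding locally_finite_vectors_def using span_base[of v "{v}"] by blast
    moreover have "lie_submodule UNIV scale act (locally_finite_vectors heisenberg)"
      by (rule lie_submodule_locally_finite_vectors[OF _ sch_basis_spans heisenberg_ideal]) simp
    ultimately have "locally_finite_vectors heisenberg = UNIV"
      using assms v(1) unfolding simple_lie_module_def by blast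
    then show "locally_finite heisenberg scale act"
      unfolding locally_finite_def locally_finite_vectors_def by blast
  qed
qed

end
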